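(* Let $(X,d)$ be an infinite metric space, let $\mathfrak{B}$ be a bornology on $X$ with a compact base such that $X\notin\mathfrak{B}$, and let $\mathfrak{m}$ be an infinite cardinal. The following statements are equivalent. (1) The $T$-tightness satisfies $T(C(X),\tau^s_{\mathfrak{B}})\le\mathfrak{m}$. (2) For every $n\in\mathbb{N}$, $X^n$ is an $[\mathfrak{m}^+,\infty]_r$-$(\mathfrak{B}^n)^s$ space.
   Context: A bornology on a set $X$ is a family $\mathfrak{B}$ of subsets of $X$ that covers $X$, is closed under finite unions and is closed under taking subsets. A base of $\mathfrak{B}$ is a subfamily $\mathfrak{B}_0\subseteq\mathfrak{B}$ such that every $B\in\mathfrak{B}$ is contained in some $B_0\in\mathfrak{B}_0$; it is a compact base if all its members are compact. For $B\subseteq X$ and $\delta>0$, $B^\delta=\bigcup_{x\in B}\{y\in X: d(x,y)<\delta\}$. $C(X)$ is the set of continuous functions $X\to\mathbb{R}$. The topology $\tau^s_{\mathfrak{B}}$ of strong uniform convergence on $\mathfrak{B}$ is the topology on $C(X)$ induced by the uniformity with base consisting of the sets $[B,\varepsilon]^s=\{(f,g): \exists\delta>0\ \forall x\in B^\delta,\ |f(x)-g(x)|<\varepsilon\}$, $B\in\mathfrak{B}$, $\varepsilon>0$. An open $\mathfrak{B}^s$-cover of $X$ is a family $\mathcal{U}$ of open subsets of $X$ that covers $X$ with $X\notin\mathcal{U}$ such that for every $B\in\mathfrak{B}$ there are $U\in\mathcal{U}$ and $\delta>0$ with $B^\delta\subseteq U$. $X^n$ carries the max metric $d^n(x,y)=\max_i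 d(x_i,y_i)$, and $\mathfrak{B}^n$ is the bornology on $X^n$ generated by $\{B^n:B\in\mathfrak{B}\}$, i.e. $A\in\mathfrak{B}^n$ iff $A\subseteq B^n$ (the $n$-fold product of $B$) for some $B\in\mathfrak{B}$; open $(\mathfrak{B}^n)^s$-covers of $X^n$ are defined in the same way. For infinite cardinals $\mathfrak{a}\le\mathfrak{b}$, a metric space $X$ with bornology $\mathfrak{B}$ is an $[\mathfrak{a},\mathfrak{b}]_r$-$\mathfrak{B}^s$ space if every open $\mathfrak{B}^s$-cover of $X$ whose cardinality is a regular cardinal $\kappa$ with $\mathfrak{a}\le\kappa\le\mathfrak{b}$ has an open $\mathfrak{B}^s$-subcover of cardinality less than $\kappa$. It is an $[\mathfrak{a},\infty]_r$-$\mathfrak{B}^s$ space if it is an $[\mathfrak{a},\mathfrak{b}]_r$-$\mathfrak{B}^s$ space for all $\mathfrak{b}\ge\mathfrak{a}$. $\mathfrak{m}^+$ is the successor cardinal of $\mathfrak{m}$. The $T$-tightness $T(Y)$ of a space $Y$ is the smallest infinite cardinal $\mathfrak{m}$ such that whenever $\kappa>\mathfrak{m}$ is a regular cardinal and $\{F_\alpha:\alpha<\kappa\}$ is an increasing family of closed subsets of $Y$, the union $\bigcup_{\alpha<\kappa}F_\alpha$ is closed in $Y$. *)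

theory Defs
  imports "HOL-Analysis.Analysis"
begin

unbundle cardinal_syntax
no_notation elt_set_eq (infix "=o" 50)

section \<open>Bornologies\<close>

text \<open>The empty union is included, so the empty set always belongs to a bornology.\<close>

definition bornology_on :: "'a set \<Rightarrow> 'a set set \<Rightarrow> bool" where
  "bornology_on X \<BB> \<longleftrightarrow>
     \<Union>\<BB> = X \<and>
     (\<forall>\<F>. finite \<F> \<and> \<F> \<subseteq> \<BB> \<longrightarrow> \<Union>\<F> \<in> \<BB>) \<and>
     (\<forall>B\<in>\<BB>. \<forall>A. A \<subseteq> B \<longrightarrow> A \<in> \<BB>)"

definition bornology_base :: "'a set set \<Rightarrow> 'a set set \<Rightarrow> bool" where
  "bornology_base \<BB> \<BB>\<^sub>0 \<longleftrightarrow> \<BB>\<^sub>0 \<subseteq> \<BB> \<and> (\<forall>B\<in>\<BB>. \<exists>B\<^sub>0\<in>\<BB>\<^sub>0. B \<subseteq> B\<^sub>0)"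

definition has_compact_base :: "'a set \<Rightarrow> ('a \<Rightarrow> 'a \<Rightarrow> real) \<Rightarrow> 'a set set \<Rightarrow> bool" where
  "has_compact_base X d \<BB> \<longleftrightarrow>
     (\<exists>\<BB>\<^sub>0. bornology_base \<BB> \<BB>\<^sub>0 \<and> (\<forall>B\<in>\<BB>\<^sub>0. compactin (Metric_space.mtopology X d) B))"

section \<open>Strong uniform convergence on a bornology\<close>

definition enlargement :: "'a set \<Rightarrow> ('a \<Rightarrow> 'a \<Rightarrow> real) \<Rightarrow> 'a set \<Rightarrow> real \<Rightarrow> 'a set" where
  "enlargement X d B \<delta> = (\<Union>x\<in>B. Metric_space.mball X d x \<delta>)"

text \<open>Functions on the carrier are represented by their extensional representatives, so that
  equality of functions is equality on the carrier.\<close>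

definition cont_funs :: "'a set \<Rightarrow> ('a \<Rightarrow> 'a \<Rightarrow> real) \<Rightarrow> ('a \<Rightarrow> real) set" where
  "cont_funs X d =
     {f \<in> extensional X. continuous_map (Metric_space.mtopology X d) euclideanreal f}"

definition strong_entourage ::
  "'a set \<Rightarrow> ('a \<Rightarrow> 'a \<Rightarrow> real) \<Rightarrow> 'a set \<Rightarrow> real \<Rightarrow> (('a \<Rightarrow> real) \<times> ('a \<Rightarrow> real)) set" where
  "strong_entourage X d B \<epsilon> =
     {(f, g). f \<in> cont_funs X d \<and> g \<in> cont_funs X d \<and>
        (\<exists>\<delta>>0. \<forall>x \<in> enlargement X d B \<delta>. \<bar>f x - g x\<bar> < \<epsilon>)}"

definition strong_open ::
  "'a set \<Rightarrow> ('a \<Rightarrow> 'a \<Rightarrow> real) \<Rightarrow> 'a set set \<Rightarrow> ('a \<Rightarrow> real) set \<Rightarrow> bool" where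
  "strong_open X d \<BB> W \<longleftrightarrow>
     W \<subseteq> cont_funs X d \<and>
     (\<forall>f\<in>W. \<exists>B\<in>\<BB>. \<exists>\<epsilon>>0. strong_entourage X d B \<epsilon> `` {f} \<subseteq> W)"

text \<open>The topology induced by the uniformity with base \<^term>\<open>strong_entourage X d B \<epsilon>\<close>; that
  \<^term>\<open>strong_open X d \<BB>\<close> really is a topology for a bornology is proved in
  \<open>openin_strong_topology\<close> below.\<close>

definition strong_topology ::
  "'a set \<Rightarrow> ('a \<Rightarrow> 'a \<Rightarrow> real) \<Rightarrow> 'a set set \<Rightarrow> ('a \<Rightarrow> real) topology" where
  "strong_topology X d \<BB> = topology (strong_open X d \<BB>)"

lemma enlargement_mono:
  assumes "Metric_space X d" "B \<subseteq> B'" "\<delta> \<le> \<delta>'"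
  shows "enlargement X d B \<delta> \<subseteq> enlargement X d B' \<delta>'"
proof -
  interpret Metric_space X d by fact
  show ?thesis
    unfolding enlargement_def using assms(2,3) by fastforce
qed

lemma strong_entourage_mono:
  assumes "Metric_space X d" "B \<subseteq> B'" "\<epsilon>' \<le> \<epsilon>"
  shows "strong_entourage X d B' \<epsilon>' \<subseteq> strong_entourage X d B \<epsilon>"
proof -
  have "enlargement X d B \<delta> \<subseteq> enlargement X d B' \<delta>" for \<delta>
    using assms(1,2) by (rule enlargement_mono) simp
  then show ?thesis
    unfolding strong_entourage_def using assms(3)
    by clarsimp (meson order_less_le_trans subsetD)
qed

lemma openin_strong_topology:
  assumes X: "Metric_space X d" and B: "bornology_on X \<BB>"
  shows "openin (strong_topology X d \<BB>) = strong_open X d \<BB>"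
proof -
  have un: "A \<union> B \<in> \<BB>" if "A \<in> \<BB>" "B \<in> \<BB>" for A B
  proof -
    have "\<Union>{A, B} \<in> \<BB>"
      using B that unfolding bornology_on_def
      by (metis empty_subsetI finite.emptyI finite.insertI insert_subset)
    then show ?thesis by simp
  qed
  have "istopology (strong_open X d \<BB>)"
    unfolding istopology_def
  proof (intro conjI allI impI)
    fix S T assume S: "strong_open X d \<BB> S" and T: "strong_open X d \<BB> T"
    show "strong_open X d \<BB> (S \<inter> T)"
      unfolding strong_open_def
    proof (intro conjI ballI)
      show "S \<inter> T \<subseteq> cont_funs X d"
        using S by (auto simp: strong_open_def)
      fix f assume f: "f \<in> S \<inter> T"
      obtain B1 e1 where 1: "B1 \<in> \<BB>" "e1 > 0" "strong_entourage X d B1 e1 `` {f} \<subseteq> S"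
        using S f unfolding strong_open_def by blast
      obtain B2 e2 where 2: "B2 \<in> \<BB>" "e2 > 0" "strong_entourage X d B2 e2 `` {f} \<subseteq> T"
        using T f unfolding strong_open_def by blast
      have "strong_entourage X d (B1 \<union> B2) (min e1 e2) \<subseteq> strong_entourage X d B1 e1"
        "strong_entourage X d (B1 \<union> B2) (min e1 e2) \<subseteq> strong_entourage X d B2 e2"
        by (rule strong_entourage_mono[OF X]; simp)+
      then have "strong_entourage X d (B1 \<union> B2) (min e1 e2) `` {f} \<subseteq> S \<inter> T"
        using 1(3) 2(3) by blast
      moreover have "B1 \<union> B2 \<in> \<BB>" "min e1 e2 > 0"
        using un 1 2 by auto
      ultimately show "\<exists>B\<in>\<BB>. \<exists>\<epsilon>>0. strong_entourage X d B \<epsilon> `` {f} \<subseteq> S \<inter> T"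
        by blast
    qed
  next
    fix \<K> assume "\<forall>K\<in>\<K>. strong_open X d \<BB> K"
    then show "strong_open X d \<BB> (\<Union>\<K>)"
      unfolding strong_open_def by (meson Sup_le_iff Union_iff Union_upper order_trans)
  qed
  then show ?thesis
    unfolding strong_topology_def by (rule topology_inverse')
qed

lemma topspace_strong_topology:
  assumes X: "Metric_space X d" and B: "bornology_on X \<BB>"
  shows "topspace (strong_topology X d \<BB>) = cont_funs X d"
proof -
  have "{} \<in> \<BB>"
    using B unfolding bornology_on_def by (metis Union_empty empty_subsetI finite.emptyI)
  then have "strong_open X d \<BB> (cont_funs X d)"
    by (auto simp: strong_open_def strong_entourage_def intro!: exI[of _ "1::real"])
  then show ?thesis
    unfolding topspace_def openin_strong_topology[OF assms] by (auto simp: strong_open_def)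
qed

section \<open>Open covers with respect to a bornology\<close>

definition open_bs_cover ::
  "'a set \<Rightarrow> ('a \<Rightarrow> 'a \<Rightarrow> real) \<Rightarrow> 'a set set \<Rightarrow> 'a set set \<Rightarrow> bool" where
  "open_bs_cover X d \<BB> \<U> \<longleftrightarrow>
     (\<forall>U\<in>\<U>. openin (Metric_space.mtopology X d) U) \<and>
     \<Union>\<U> = X \<and> X \<notin> \<U> \<and>
     (\<forall>B\<in>\<BB>. \<exists>U\<in>\<U>. \<exists>\<delta>>0. enlargement X d B \<delta> \<subseteq> U)"

text \<open>Cardinals are the well-orders satisfying \<^const>\<open>Card_order\<close>.  The regular
  cardinal \<open>\<kappa>\<close> is the cardinality \<open>|\<U>|\<close> of the cover.\<close>

definition regular_bs_space ::
  "'a set \<Rightarrow> ('a \<Rightarrow> 'a \<Rightarrow> real) \<Rightarrow> 'a set set \<Rightarrow> 'c rel \<Rightarrow> 'e rel \<Rightarrow> bool" where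
  "regular_bs_space X d \<BB> \<aa> \<bb> \<longleftrightarrow>
     (\<forall>\<U>. open_bs_cover X d \<BB> \<U> \<and> regularCard |\<U>| \<and> \<aa> \<le>o |\<U>| \<and> |\<U>| \<le>o \<bb> \<longrightarrow>
        (\<exists>\<V>\<subseteq>\<U>. open_bs_cover X d \<BB> \<V> \<and> |\<V>| <o |\<U>| ))"

text \<open>The upper bound ranges over cardinals on the type of subsets, which loses nothing: every
  cover has cardinality at most that of this type.  See \<open>regular_bs_space_infinity_iff\<close>.\<close>

definition regular_bs_space_infinity ::
  "'a set \<Rightarrow> ('a \<Rightarrow> 'a \<Rightarrow> real) \<Rightarrow> 'a set set \<Rightarrow> 'c rel \<Rightarrow> bool" where
  "regular_bs_space_infinity X d \<BB> \<aa> \<longleftrightarrow>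
     (\<forall>\<bb> :: 'a set rel. Card_order \<bb> \<and> \<aa> \<le>o \<bb> \<longrightarrow> regular_bs_space X d \<BB> \<aa> \<bb>)"

lemma regular_bs_space_infinity_iff:
  "regular_bs_space_infinity X d \<BB> \<aa> \<longleftrightarrow>
     (\<forall>\<U>. open_bs_cover X d \<BB> \<U> \<and> regularCard |\<U>| \<and> \<aa> \<le>o |\<U>| \<longrightarrow>
        (\<exists>\<V>\<subseteq>\<U>. open_bs_cover X d \<BB> \<V> \<and> |\<V>| <o |\<U>| ))"
  unfolding regular_bs_space_infinity_def regular_bs_space_def
  using card_of_Card_order ordLeq_reflexive card_of_Well_order by blast

section \<open>Finite powers\<close>

definition power_set :: "nat \<Rightarrow> 'a set \<Rightarrow> (nat \<Rightarrow> 'a) set" where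
  "power_set n X = ({..<n} \<rightarrow>\<^sub>E X)"

definition power_dist ::
  "nat \<Rightarrow> ('a \<Rightarrow> 'a \<Rightarrow> real) \<Rightarrow> (nat \<Rightarrow> 'a) \<Rightarrow> (nat \<Rightarrow> 'a) \<Rightarrow> real" where
  "power_dist n d x y = Max ((\<lambda>i. d (x i) (y i)) ` {..<n})"

definition power_bornology :: "nat \<Rightarrow> 'a set set \<Rightarrow> (nat \<Rightarrow> 'a) set set" where
  "power_bornology n \<BB> = {A. \<exists>B\<in>\<BB>. A \<subseteq> power_set n B}"

lemma Metric_space_power:
  assumes "Metric_space X d" "n \<ge> 1"
  shows "Metric_space (power_set n X) (power_dist n d)"
proof -
  interpret Metric_space X d by fact
  have ne: "{..<n} \<noteq> {}" using assms(2) by (auto simp: lessThan_empty_iff)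
  have le_iff: "power_dist n d x y \<le> c \<longleftrightarrow> (\<forall>i<n. d (x i) (y i) \<le> c)" for x y c
    unfolding power_dist_def using ne by (subst Max_le_iff) auto
  have ge: "d (x i) (y i) \<le> power_dist n d x y" if "i < n" for x y i
    using le_iff that by blast
  show ?thesis
  proof
    show nonneg': "0 \<le> power_dist n d x y" for x y
      using ge[of 0 x y] nonneg[of "x 0" "y 0"] assms(2) by linarith
    show "power_dist n d x y = power_dist n d y x" for x y
      by (simp add: power_dist_def commute)
    show "power_dist n d x y = 0 \<longleftrightarrow> x = y"
      if x: "x \<in> power_set n X" and y: "y \<in> power_set n X" for x y
    proof -
      have "power_dist n d x y = 0 \<longleftrightarrow> power_dist n d x y \<le> 0"
        using nonneg'[of x y] by linarith
      also have "\<dots> \<longleftrightarrow> (\<forall>i<n. d (x i) (y i) = 0)"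
        unfolding le_iff using nonneg by (simp add: order_antisym_conv)
      also have "\<dots> \<longleftrightarrow> (\<forall>i<n. x i = y i)"
        using x y unfolding power_set_def by (metis PiE_mem lessThan_iff zero)
      also have "\<dots> \<longleftrightarrow> x = y"
        using x y unfolding power_set_def by (metis PiE_ext lessThan_iff)
      finally show ?thesis .
    qed
    show "power_dist n d x z \<le> power_dist n d x y + power_dist n d y z"
      if "x \<in> power_set n X" "y \<in> power_set n X" "z \<in> power_set n X" for x y z
      unfolding le_iff
    proof (intro allI impI)
      fix i assume i: "i < n"
      have "d (x i) (z i) \<le> d (x i) (y i) + d (y i) (z i)"
        using that i by (intro triangle) (auto simp: power_set_def)
      then show "d (x i) (z i) \<le> power_dist n d x y + power_dist n d y z"
        using ge[OF i, of x y] ge[OF i, of y z] by linarith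
    qed
  qed
qed

section \<open>T-tightness\<close>

text \<open>The cardinal \<open>\<kappa>\<close> ranges over cardinals on the type of subsets of the space, which loses
  nothing: a chain indexed by a larger regular cardinal is eventually constant.  See
  \<open>chain_unions_closedD\<close>.\<close>

definition chain_unions_closed :: "'y topology \<Rightarrow> 'm rel \<Rightarrow> bool" where
  "chain_unions_closed Y \<mm> \<longleftrightarrow>
     (\<forall>(\<kappa> :: 'y set rel) F.
        Card_order \<kappa> \<and> regularCard \<kappa> \<and> \<mm> <o \<kappa> \<and>
        (\<forall>\<alpha>\<in>Field \<kappa>. closedin Y (F \<alpha>)) \<and> relChain \<kappa> F \<longrightarrow>
        closedin Y (\<Union>\<alpha>\<in>Field \<kappa>. F \<alpha>))"

text \<open>Up to isomorphism of well-orders, the least infinite cardinal \<open>t\<close> with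
  \<^term>\<open>chain_unions_closed Y t\<close>; it is at most \<open>max |Y| \<aleph>\<^sub>0\<close> and hence represented on the type
  below.  See \<open>T_tightness_least\<close>.\<close>

definition T_tightness :: "'y topology \<Rightarrow> ('y + nat) rel" where
  "T_tightness Y =
     (SOME t. Cinfinite t \<and> chain_unions_closed Y t \<and>
        (\<forall>t' :: ('y + nat) rel. Cinfinite t' \<and> chain_unions_closed Y t' \<longrightarrow> t \<le>o t'))"

lemma Card_order_represent:
  assumes "Card_order r" "r \<le>o |UNIV :: 'b set|"
  shows "\<exists>A :: 'b set. |A| =o r"
proof -
  have *: "|Field r| =o r" using assms(1) by (rule card_of_Field_ordIso)
  then have "|Field r| \<le>o |UNIV :: 'b set|" using assms(2) by (rule ordIso_ordLeq_trans)
  then obtain f :: "_ \<Rightarrow> 'b" where f: "inj_on f (Field r)"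
    unfolding card_of_ordLeq[symmetric] by blast
  have "|f ` Field r| =o |Field r|"
    using inj_on_imp_bij_betw[OF f] by (metis card_of_ordIso ordIso_symmetric)
  then show ?thesis using * ordIso_transitive by blast
qed

lemma Cinfinite_ordLess:
  assumes "Cinfinite m" "m <o k" "Card_order k" shows "Cinfinite k"
  using assms cinfinite_mono ordLess_imp_ordLeq by blast

lemma chain_union_closed_large:
  fixes F :: "'k \<Rightarrow> 'y set"
  assumes "Card_order \<kappa>" "cinfinite \<kappa>" "regularCard \<kappa>" "|UNIV :: 'y set| <o \<kappa>"
    "\<forall>\<alpha>\<in>Field \<kappa>. closedin Y (F \<alpha>)" "relChain \<kappa> F"
  shows "closedin Y (\<Union>\<alpha>\<in>Field \<kappa>. F \<alpha>)"
proof -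
  let ?B = "\<Union>\<alpha>\<in>Field \<kappa>. F \<alpha>"
  have "|?B| <o \<kappa>"
    by (rule ordLeq_ordLess_trans[OF _ assms(4)]) (simp add: card_of_mono1)
  then have "\<exists>i\<in>Field \<kappa>. ?B \<subseteq> F i"
    using assms by (intro regularCard_UNION[OF assms(1,3,6)]) (auto simp: cinfinite_def)
  then obtain i where "i \<in> Field \<kappa>" "?B = F i" by blast
  then show ?thesis using assms(5) by simp
qed

lemma chain_unions_closedD:
  fixes F :: "'k \<Rightarrow> 'y set"
  assumes "Cinfinite m" "chain_unions_closed Y m"
    "Card_order \<kappa>" "regularCard \<kappa>" "m <o \<kappa>"
    "\<forall>\<alpha>\<in>Field \<kappa>. closedin Y (F \<alpha>)" "relChain \<kappa> F"
  shows "closedin Y (\<Union>\<alpha>\<in>Field \<kappa>. F \<alpha>)"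
proof -
  have inf: "Cinfinite \<kappa>" using Cinfinite_ordLess assms(1,3,5) by blast
  show ?thesis
  proof (cases "\<kappa> \<le>o |UNIV :: 'y set set|")
    case True
    then obtain A :: "'y set set" where A: "|A| =o \<kappa>"
      using Card_order_represent[OF assms(3)] by blast
    then obtain h where h: "iso |A| \<kappa> h" unfolding ordIso_def by blast
    have img: "h ` Field |A| = Field \<kappa>" using h unfolding iso_def bij_betw_def by blast
    have A': "\<kappa> =o |A|" using A by (rule ordIso_symmetric)
    have "closedin Y (\<Union>\<alpha>\<in>Field |A|. (F \<circ> h) \<alpha>)"
    proof (rule assms(2)[unfolded chain_unions_closed_def, rule_format], intro conjI)
      show "Card_order |A|" by (rule card_of_Card_order)
      show "regularCard |A|" using regularCard_ordIso[OF A' inf assms(4)] .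
      show "m <o |A|" using assms(5) A' by (rule ordLess_ordIso_trans)
      show "\<forall>\<alpha>\<in>Field |A|. closedin Y ((F \<circ> h) \<alpha>)" using assms(6) img by auto
      show "relChain |A| (F \<circ> h)"
        using assms(7) iso_forward[OF _ h] unfolding relChain_def by simp
    qed
    then show ?thesis unfolding img[symmetric] by (simp add: image_comp)
  next
    case False
    then have "|UNIV :: 'y set set| <o \<kappa>"
      using assms(3) card_of_Well_order not_ordLeq_iff_ordLess card_order_on_well_order_on by metis
    moreover have "|UNIV :: 'y set| \<le>o |UNIV :: 'y set set|"
      using card_of_Pow[of "UNIV :: 'y set"] by (simp add: ordLess_imp_ordLeq)
    ultimately have "|UNIV :: 'y set| <o \<kappa>" by (rule ordLeq_ordLess_trans[rotated])
    then show ?thesis using chain_union_closed_large assms inf by blast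
  qed
qed

lemma chain_unions_closed_mono:
  assumes "chain_unions_closed Y m" "m \<le>o m'"
  shows "chain_unions_closed Y m'"
  using assms ordLeq_ordLess_trans unfolding chain_unions_closed_def by blast

lemma Cinfinite_sum_nat: "Cinfinite |UNIV :: ('y + nat) set|"
  by (simp add: cinfinite_def Field_card_of card_of_card_order_on finite_Plus_UNIV_iff)

lemma chain_unions_closed_card:
  "chain_unions_closed (Y :: 'y topology) |UNIV :: ('y + nat) set|"
  unfolding chain_unions_closed_def
proof (intro allI impI, elim conjE)
  fix \<kappa> :: "'y set rel" and F
  assume k: "Card_order \<kappa>" "regularCard \<kappa>" "|UNIV :: ('y + nat) set| <o \<kappa>"
    "\<forall>\<alpha>\<in>Field \<kappa>. closedin Y (F \<alpha>)" "relChain \<kappa> F"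
  have "|UNIV :: 'y set| \<le>o |UNIV :: ('y + nat) set|"
    unfolding card_of_ordLeq[symmetric] by (rule exI[of _ Inl]) auto
  then have "|UNIV :: 'y set| <o \<kappa>" using k(3) by (rule ordLeq_ordLess_trans)
  moreover have "cinfinite \<kappa>" using Cinfinite_ordLess[OF Cinfinite_sum_nat k(3,1)] by blast
  ultimately show "closedin Y (\<Union>\<alpha>\<in>Field \<kappa>. F \<alpha>)" using chain_union_closed_large k by blast
qed

lemma T_tightness_props:
  fixes Y :: "'y topology"
  shows "Cinfinite (T_tightness Y) \<and> chain_unions_closed Y (T_tightness Y) \<and>
    (\<forall>t' :: ('y + nat) rel. Cinfinite t' \<and> chain_unions_closed Y t' \<longrightarrow> T_tightness Y \<le>o t')"
proof -
  let ?R = "{t :: ('y + nat) rel. Cinfinite t \<and> chain_unions_closed Y t}"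
  have "?R \<noteq> {}" using Cinfinite_sum_nat chain_unions_closed_card by blast
  moreover have "\<forall>r\<in>?R. Card_order r" by blast
  ultimately have "\<exists>t\<in>?R. \<forall>t'\<in>?R. t \<le>o t'" by (intro exists_minim_Card_order)
  then have "\<exists>t :: ('y + nat) rel. Cinfinite t \<and> chain_unions_closed Y t \<and>
      (\<forall>t' :: ('y + nat) rel. Cinfinite t' \<and> chain_unions_closed Y t' \<longrightarrow> t \<le>o t')"
    by simp
  then show ?thesis unfolding T_tightness_def by (rule someI_ex)
qed

lemma T_tightness_least:
  fixes Y :: "'y topology" and m :: "'m rel"
  assumes m: "Cinfinite m"
  shows "T_tightness Y \<le>o m \<longleftrightarrow> chain_unions_closed Y m"
proof
  show "T_tightness Y \<le>o m \<Longrightarrow> chain_unions_closed Y m"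
    using T_tightness_props chain_unions_closed_mono by blast
next
  assume c: "chain_unions_closed Y m"
  show "T_tightness Y \<le>o m"
  proof (cases "m \<le>o |UNIV :: ('y + nat) set|")
    case True
    then obtain A :: "('y + nat) set" where A: "|A| =o m"
      using Card_order_represent m by blast
    have "m =o |A|" using A by (rule ordIso_symmetric)
    then have "Cinfinite |A|" "chain_unions_closed Y |A|"
      using m c Cinfinite_cong chain_unions_closed_mono ordIso_iff_ordLeq by blast+
    then have "T_tightness Y \<le>o |A|" using T_tightness_props by blast
    then show ?thesis using A by (rule ordLeq_ordIso_trans)
  next
    case False
    then have "|UNIV :: ('y + nat) set| \<le>o m"
      using m ordLeq_total card_of_Well_order card_order_on_well_order_on by metis
    moreover have "T_tightness Y \<le>o |UNIV :: ('y + nat) set|"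
      using T_tightness_props Cinfinite_sum_nat chain_unions_closed_card by blast
    ultimately show ?thesis by (rule ordLeq_transitive[rotated])
  qed
qed

end

theory Submission
  imports Defs
begin

text \<open>
  (1) implies (2): well-order a cover \<open>\<U>\<close> of \<open>X\<^sup>n\<close> by its cardinal and let \<open>A V\<close> be the set of
  continuous \<open>f\<close> such that the \<open>n\<close>-th power of \<open>{f < 1}\<close> lies in some member of \<open>\<U>\<close> below \<open>V\<close>.
  Urysohn functions put \<open>0\<close> into the closure of the union of the \<open>A V\<close>; by T-tightness it lies
  in the closure of a single \<open>A V\<close>, and then the members below \<open>V\<close> already form a cover.

  (2) implies (1): only \<open>n = 1\<close> is needed, because it already forces density at most \<open>\<mm>\<close>.  A
  uniformly discrete set of cardinality \<open>\<mm>\<^sup>+\<close>, enumerated as \<open>x\<^sub>\<alpha>\<close>, would give the increasing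
  cover by the sets \<open>X - {x\<^sub>\<beta> | \<beta> > \<alpha>}\<close>, which has no smaller subcover since \<open>\<mm>\<^sup>+\<close> is regular.
  Given a dense set of cardinality at most \<open>\<mm>\<close>, finite unions of balls with centres in it and
  radii \<open>1/(j+1)\<close> are fine enough to test strong uniform convergence on totally bounded sets, so
  at most \<open>\<mm>\<close> members of the union of a chain suffice to approximate a point of its closure.
\<close>

section \<open>Closure in the topology of strong uniform convergence\<close>

text \<open>Right to left unfolds \<open>strong_open\<close>. Left to right needs an actual open set
  inside the entourage slice at \<open>f\<close>, because the definition of the topology does not
  make the slice itself open.\<close>

lemma in_strong_closure_of_iff:
  assumes X: "Metric_space X d" and \<BB>: "bornology_on X \<BB>" and S: "S \<subseteq> cont_funs X d"
  shows "f \<in> strong_topology X d \<BB> closure_of S \<longleftrightarrow>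
    f \<in> cont_funs X d \<and> (\<forall>B\<in>\<BB>. \<forall>\<epsilon>>0. \<exists>g\<in>S. (f, g) \<in> strong_entourage X d B \<epsilon>)"
    (is "_ \<longleftrightarrow> ?R")
proof
  assume f: "f \<in> strong_topology X d \<BB> closure_of S"
  then have fC: "f \<in> cont_funs X d"
    using topspace_strong_topology[OF X \<BB>] by (simp add: in_closure_of)
  have "\<exists>g\<in>S. (f, g) \<in> strong_entourage X d B \<epsilon>" if B: "B \<in> \<BB>" and e: "\<epsilon> > 0" for B \<epsilon>
  proof -
    \<comment> \<open>Admitting only radii strictly below \<open>\<epsilon>\<close> leaves a gap for
      the triangle inequality, so this part of the slice is open.\<close>
    let ?W = "{g. \<exists>\<epsilon>'<\<epsilon>. (f, g) \<in> strong_entourage X d B \<epsilon>'}"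
    have "strong_open X d \<BB> ?W"
      unfolding strong_open_def
    proof (intro conjI ballI)
      show "?W \<subseteq> cont_funs X d" by (auto simp: strong_entourage_def)
      fix g assume "g \<in> ?W"
      then obtain \<epsilon>' where \<epsilon>': "\<epsilon>' < \<epsilon>" "(f, g) \<in> strong_entourage X d B \<epsilon>'" by blast
      define \<eta> where "\<eta> = (\<epsilon> - \<epsilon>') / 2"
      have \<eta>: "\<eta> > 0" "\<epsilon>' + \<eta> < \<epsilon>" using \<epsilon>' by (auto simp: \<eta>_def field_simps)
      have "(f, h) \<in> strong_entourage X d B (\<epsilon>' + \<eta>)" if gh: "(g, h) \<in> strong_entourage X d B \<eta>" for h
      proof -
        obtain \<delta> where \<delta>: "\<delta> > 0" "\<forall>x\<in>enlargement X d B \<delta>. \<bar>f x - g x\<bar> < \<epsilon>'"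
          using \<epsilon>' by (auto simp: strong_entourage_def)
        obtain \<delta>' where \<delta>': "\<delta>' > 0" "\<forall>x\<in>enlargement X d B \<delta>'. \<bar>g x - h x\<bar> < \<eta>"
          using gh by (auto simp: strong_entourage_def)
        have "\<bar>f x - h x\<bar> < \<epsilon>' + \<eta>" if "x \<in> enlargement X d B (min \<delta> \<delta>')" for x
        proof -
          have "x \<in> enlargement X d B \<delta>" "x \<in> enlargement X d B \<delta>'"
            using that enlargement_mono[OF X order_refl, of "min \<delta> \<delta>'" \<delta> B]
              enlargement_mono[OF X order_refl, of "min \<delta> \<delta>'" \<delta>' B] by auto
          then have "\<bar>f x - g x\<bar> < \<epsilon>'" "\<bar>g x - h x\<bar> < \<eta>" using \<delta> \<delta>' by auto
          then show ?thesis by linarith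
        qed
        moreover have "min \<delta> \<delta>' > 0" using \<delta> \<delta>' by simp
        ultimately show ?thesis
          using \<epsilon>' gh unfolding strong_entourage_def by blast
      qed
      then have "strong_entourage X d B \<eta> `` {g} \<subseteq> ?W" using \<eta> by blast
      then show "\<exists>B\<in>\<BB>. \<exists>\<epsilon>>0. strong_entourage X d B \<epsilon> `` {g} \<subseteq> ?W" using B \<eta> by blast
    qed
    moreover have "(f, f) \<in> strong_entourage X d B (\<epsilon>/2)"
      using e fC by (auto simp: strong_entourage_def intro!: exI[of _ "1::real"])
    then have "f \<in> ?W" using field_sum_of_halves[of \<epsilon>] e by (intro CollectI exI[of _ "\<epsilon>/2"]) auto
    ultimately have "\<exists>g. g \<in> S \<and> g \<in> ?W"
      using f unfolding in_closure_of openin_strong_topology[OF X \<BB>]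
      by (elim conjE allE[of _ ?W]) blast
    then obtain g where g: "g \<in> S" "g \<in> ?W" by (elim exE conjE)
    then obtain \<epsilon>' where "\<epsilon>' < \<epsilon>" "(f, g) \<in> strong_entourage X d B \<epsilon>'" by blast
    then show ?thesis
      using g strong_entourage_mono[OF X order_refl, of \<epsilon>' \<epsilon> B] by (meson less_imp_le subsetD)
  qed
  with fC show ?R by blast
next
  assume ?R
  then show "f \<in> strong_topology X d \<BB> closure_of S"
    unfolding in_closure_of openin_strong_topology[OF X \<BB>] topspace_strong_topology[OF X \<BB>]
      strong_open_def by blast
qed

section \<open>Enlargements in finite powers\<close>

lemma in_power_mball_iff:
  assumes "Metric_space X d" "n \<ge> 1"
  shows "y \<in> Metric_space.mball (power_set n X) (power_dist n d) x r \<longleftrightarrow>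
    x \<in> power_set n X \<and> y \<in> power_set n X \<and> (\<forall>i<n. d (x i) (y i) < r)"
proof -
  interpret P: Metric_space "power_set n X" "power_dist n d"
    using assms by (rule Metric_space_power)
  have "{..<n} \<noteq> {}" using assms(2) by (auto simp: lessThan_empty_iff)
  then have "power_dist n d x y < r \<longleftrightarrow> (\<forall>i<n. d (x i) (y i) < r)"
    unfolding power_dist_def by (subst Max_less_iff) auto
  then show ?thesis by simp
qed

text \<open>Balls of the max metric are products of balls, so centres can be chosen coordinate by
  coordinate. Strong covers of the power can thus be tested by enlargements in
  \<open>X\<close>.\<close>

lemma enlargement_power:
  assumes X: "Metric_space X d" and n: "n \<ge> 1"
  shows "enlargement (power_set n X) (power_dist n d) (power_set n B) \<delta> =
    power_set n (enlargement X d B \<delta>)"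
proof -
  interpret Metric_space X d by fact
  show ?thesis
  proof (intro set_eqI iffI)
    fix y assume "y \<in> enlargement (power_set n X) (power_dist n d) (power_set n B) \<delta>"
    then obtain x where "x \<in> power_set n B" "x \<in> power_set n X" "y \<in> power_set n X"
      "\<forall>i<n. d (x i) (y i) < \<delta>"
      unfolding enlargement_def using in_power_mball_iff[OF X n] by auto
    then show "y \<in> power_set n (enlargement X d B \<delta>)"
      unfolding power_set_def enlargement_def PiE_iff by fastforce
  next
    fix y assume y: "y \<in> power_set n (enlargement X d B \<delta>)"
    then have "\<forall>i<n. \<exists>b. b \<in> B \<and> b \<in> X \<and> y i \<in> X \<and> d b (y i) < \<delta>"
      unfolding power_set_def enlargement_def PiE_iff by auto
    then obtain x where x: "\<And>i. i < n \<Longrightarrow> x i \<in> B \<and> x i \<in> X \<and> y i \<in> X \<and> d (x i) (y i) < \<delta>"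
      by metis
    have "y \<in> Metric_space.mball (power_set n X) (power_dist n d) (restrict x {..<n}) \<delta>"
      unfolding in_power_mball_iff[OF X n] using x y by (auto simp: power_set_def PiE_iff)
    moreover have "restrict x {..<n} \<in> power_set n B" using x by (auto simp: power_set_def)
    ultimately show "y \<in> enlargement (power_set n X) (power_dist n d) (power_set n B) \<delta>"
      unfolding enlargement_def by blast
  qed
qed

section \<open>From T-tightness to covers of the powers\<close>

lemma regular_bs_space_power:
  assumes X: "Metric_space X d" and \<BB>: "bornology_on X \<BB>" and m: "Cinfinite \<mm>"
    and tight: "chain_unions_closed (strong_topology X d \<BB>) \<mm>" and n: "n \<ge> 1"
  shows "regular_bs_space_infinity (power_set n X) (power_dist n d) (power_bornology n \<BB>)
    (cardSuc \<mm>)"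
  unfolding regular_bs_space_infinity_iff
proof (intro allI impI, elim conjE)
  fix \<U> assume cover: "open_bs_cover (power_set n X) (power_dist n d) (power_bornology n \<BB>) \<U>"
    and reg: "regularCard |\<U>|" and "cardSuc \<mm> \<le>o |\<U>|"
  interpret Metric_space X d by fact
  let ?Y = "strong_topology X d \<BB>"
  have mU: "\<mm> <o |\<U>|"
    using m \<open>cardSuc \<mm> \<le>o |\<U>|\<close> cardSuc_ordLess_ordLeq card_of_Card_order by blast
  have "Cinfinite |\<U>|" using Cinfinite_ordLess[OF m mU] by (simp add: card_of_Card_order)
  then have infU: "infinite \<U>" by (simp add: cinfinite_def Field_card_of)
  \<comment> \<open>The members of \<open>\<U>\<close> themselves index the chain, ordered by
    \<open>|\<U>|\<close>. Letting \<open>U\<close> range over everything up to \<open>V\<close>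
    makes \<open>A\<close> increasing. The threshold 1 is the value that the Urysohn functions below
    take outside an enlargement of \<open>B\<close>.\<close>
  define A where "A V = {f \<in> cont_funs X d. \<exists>U. (U, V) \<in> |\<U>| \<and> power_set n {x \<in> X. f x < 1} \<subseteq> U}"
    for V
  have AC: "A V \<subseteq> cont_funs X d" for V by (auto simp: A_def)
  have trans: "trans |\<U>|" and refl: "V \<in> \<U> \<Longrightarrow> (V, V) \<in> |\<U>|" for V
    using card_of_Well_order[of \<U>] unfolding order_on_defs refl_on_def
    by (auto simp: Field_card_of)
  define zero where "zero = restrict (\<lambda>_. 0 :: real) X"
  have zero: "zero \<in> cont_funs X d"
    by (auto simp: zero_def cont_funs_def continuous_map_from_subtopology
        intro!: continuous_map_eq[where f="\<lambda>_. 0" and g="restrict (\<lambda>_. 0) X"])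
  have "relChain |\<U>| A"
    unfolding relChain_def A_def using transD[OF trans] by blast
  \<comment> \<open>T-tightness speaks of closed sets, so the chain is replaced by its closures,
    which still increase.\<close>
  then have chain: "relChain |\<U>| (\<lambda>V. ?Y closure_of A V)"
    unfolding relChain_def by (simp add: closure_of_mono)
  have closed: "closedin ?Y (\<Union>V\<in>Field |\<U>|. ?Y closure_of A V)"
    by (rule chain_unions_closedD[OF m tight card_of_Card_order reg mU _ chain]) simp
  have "zero \<in> ?Y closure_of (\<Union>V\<in>\<U>. A V)"
    unfolding in_strong_closure_of_iff[OF X \<BB> UN_least[OF AC]]
  proof (intro conjI zero ballI allI impI)
    fix B \<epsilon> assume B: "B \<in> \<BB>" and \<epsilon>: "\<epsilon> > (0::real)"
    then have "power_set n B \<in> power_bornology n \<BB>" by (auto simp: power_bornology_def)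
    then obtain U \<delta> where U: "U \<in> \<U>" "\<delta> > 0"
      "enlargement (power_set n X) (power_dist n d) (power_set n B) \<delta> \<subseteq> U"
      using cover unfolding open_bs_cover_def by blast
    \<comment> \<open>To be close to \<open>zero\<close> in the entourage sense the function must
      vanish on a whole enlargement of \<open>B\<close>, not only on \<open>B\<close>. Halving
      \<open>\<delta>\<close> keeps the closure of that enlargement inside the
      \<open>\<delta>\<close>-enlargement, off which the function is 1.\<close>
    let ?S = "mtopology closure_of (enlargement X d B (\<delta>/2))"
    have BX: "enlargement X d B r \<subseteq> X" for r by (auto simp: enlargement_def)
    have open': "openin mtopology (enlargement X d B \<delta>)" by (auto simp: enlargement_def)
    have S: "?S \<subseteq> enlargement X d B \<delta>"
    proof
      fix x assume "x \<in> ?S"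
      then obtain y b where "x \<in> X" "y \<in> X" "d x y < \<delta>/2" "b \<in> B" "b \<in> X" "d b y < \<delta>/2"
        using U(2) half_gt_zero[OF U(2)] unfolding metric_closure_of enlargement_def by fastforce
      then show "x \<in> enlargement X d B \<delta>"
        using triangle[of b y x] commute[of x y] by (force simp: enlargement_def)
    qed
    obtain f where f: "continuous_map mtopology euclideanreal f" "f ` ?S \<subseteq> {0}"
      "f ` (X - enlargement X d B \<delta>) \<subseteq> {1}"
    proof (rule Urysohn_lemma_alt[of mtopology ?S "X - enlargement X d B \<delta>" 0 1])
      show "normal_space mtopology" by (rule normal_space_mtopology)
      show "closedin mtopology (X - enlargement X d B \<delta>)"
        using open' by (metis closedin_diff closedin_topspace topspace_mtopology)
      show "disjnt ?S (X - enlargement X d B \<delta>)" using S by (auto simp: disjnt_def)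
    qed (use that in auto)
    define g where "g = restrict f X"
    have g: "g \<in> cont_funs X d"
      unfolding cont_funs_def g_def using f(1)
      by (auto intro!: continuous_map_eq[where f=f and g="restrict f X"])
    have "{x \<in> X. g x < 1} \<subseteq> enlargement X d B \<delta>" using f(3) by (force simp: g_def)
    then have "power_set n {x \<in> X. g x < 1} \<subseteq> power_set n (enlargement X d B \<delta>)"
      unfolding power_set_def by (rule PiE_mono)
    then have "g \<in> A U"
      using U g refl unfolding enlargement_power[OF X n] A_def by blast
    moreover have "g x = 0" if "x \<in> enlargement X d B (\<delta>/2)" for x
      using that f(2) BX closure_of_subset[of "enlargement X d B (\<delta>/2)" mtopology]
      by (fastforce simp: g_def)
    then have "(zero, g) \<in> strong_entourage X d B \<epsilon>"
      using zero g \<epsilon> U(2) BX unfolding strong_entourage_def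
      by (auto simp: zero_def intro!: exI[of _ "\<delta>/2"])
    ultimately show "\<exists>g\<in>\<Union>V\<in>\<U>. A V. (zero, g) \<in> strong_entourage X d B \<epsilon>" using U(1) by blast
  qed
  moreover have "(\<Union>V\<in>\<U>. A V) \<subseteq> (\<Union>V\<in>Field |\<U>|. ?Y closure_of A V)"
    using closure_of_subset[of _ ?Y] AC topspace_strong_topology[OF X \<BB>]
    by (simp add: Field_card_of) blast
  ultimately have "zero \<in> (\<Union>V\<in>Field |\<U>|. ?Y closure_of A V)"
    using closed closure_of_minimal by blast
  then obtain V where V: "V \<in> \<U>" "zero \<in> ?Y closure_of A V" by (auto simp: Field_card_of)
  \<comment> \<open>An infinite cardinal has no last element. With \<open>W\<close> beyond
    \<open>V\<close>, the segment up to and including \<open>V\<close> lies in the proper initial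
    segment below \<open>W\<close> and so has cardinality less than \<open>|\<U>|\<close>.\<close>
  obtain W where W: "W \<in> \<U>" "V \<noteq> W" "(V, W) \<in> |\<U>|"
    using infinite_Card_order_limit[OF card_of_Card_order, of \<U> V] V infU
    by (auto simp: Field_card_of)
  define \<V> where "\<V> = {U. (U, V) \<in> |\<U>|}"
  have \<V>: "\<V> \<subseteq> \<U>" unfolding \<V>_def using Field_card_of[of \<U>] by (auto simp: Field_def)
  have "antisym |\<U>|" using card_of_Well_order[of \<U>] unfolding order_on_defs by blast
  then have "\<V> \<subseteq> underS |\<U>| W"
    unfolding \<V>_def underS_def using W transD[OF trans] antisymD by fast
  then have less: "|\<V>| <o |\<U>|"
    using card_of_underS[OF card_of_Card_order, of W \<U>] W
    by (metis Field_card_of card_of_mono1 ordLeq_ordLess_trans)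
  \<comment> \<open>A function \<open>g\<close> in \<open>A V\<close> within 1 of
    \<open>zero\<close> on an enlargement of \<open>B\<close> is below 1 there, and the power of the
    set where \<open>g\<close> is below 1 lies in a member of \<open>\<V>\<close> by the choice of
    \<open>A\<close>.\<close>
  have small: "\<exists>U\<in>\<V>. \<exists>\<delta>>0. enlargement (power_set n X) (power_dist n d) C \<delta> \<subseteq> U"
    if C: "C \<in> power_bornology n \<BB>" for C
  proof -
    obtain B where B: "B \<in> \<BB>" "C \<subseteq> power_set n B" using C by (auto simp: power_bornology_def)
    obtain g where g: "g \<in> A V" "(zero, g) \<in> strong_entourage X d B 1"
      using V(2) B(1) unfolding in_strong_closure_of_iff[OF X \<BB> AC] by (metis zero_less_one)
    then obtain \<delta> where \<delta>: "\<delta> > 0" "\<forall>x\<in>enlargement X d B \<delta>. \<bar>zero x - g x\<bar> < 1"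
      by (auto simp: strong_entourage_def)
    obtain U where U: "U \<in> \<V>" "power_set n {x \<in> X. g x < 1} \<subseteq> U"
      using g by (auto simp: A_def \<V>_def)
    have "enlargement X d B \<delta> \<subseteq> {x \<in> X. g x < 1}"
      using \<delta> by (force simp: zero_def enlargement_def)
    then have "power_set n (enlargement X d B \<delta>) \<subseteq> U"
      using U(2) unfolding power_set_def by (meson PiE_mono order_trans)
    then have "enlargement (power_set n X) (power_dist n d) C \<delta> \<subseteq> U"
      using enlargement_mono[OF Metric_space_power[OF X n] B(2) order_refl, of \<delta>]
        enlargement_power[OF X n] by auto
    then show ?thesis using U \<delta> by blast
  qed
  have "power_set n X \<subseteq> \<Union>\<V>"
  proof
    fix x assume x: "x \<in> power_set n X"
    have \<BB>': "\<Union>\<BB> = X" "\<And>\<F>. finite \<F> \<Longrightarrow> \<F> \<subseteq> \<BB> \<Longrightarrow> \<Union>\<F> \<in> \<BB>"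
        "\<And>B A. B \<in> \<BB> \<Longrightarrow> A \<subseteq> B \<Longrightarrow> A \<in> \<BB>"
      using \<BB> unfolding bornology_on_def by auto
    \<comment> \<open>A bornology contains all finite sets. The coordinates of \<open>x\<close> form
      one, and its power contains \<open>x\<close>, so \<open>small\<close> applies to
      \<open>{x}\<close>.\<close>
    have "{y} \<in> \<BB>" if "y \<in> X" for y using \<BB>'(1,3) that by blast
    then have "\<Union>((\<lambda>i. {x i}) ` {..<n}) \<in> \<BB>"
      using x by (intro \<BB>'(2)) (auto simp: power_set_def)
    moreover have "x \<in> power_set n (\<Union>((\<lambda>i. {x i}) ` {..<n}))"
      using x by (auto simp: power_set_def PiE_iff)
    ultimately have "{x} \<in> power_bornology n \<BB>" by (auto simp: power_bornology_def)
    then obtain U \<delta> where U: "U \<in> \<V>" "\<delta> > 0"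
      "enlargement (power_set n X) (power_dist n d) {x} \<delta> \<subseteq> U"
      using small by blast
    interpret P: Metric_space "power_set n X" "power_dist n d"
      using X n by (rule Metric_space_power)
    have "x \<in> U" using U x P.centre_in_mball_iff[of x \<delta>] by (auto simp: enlargement_def)
    then show "x \<in> \<Union>\<V>" using U by blast
  qed
  moreover have "\<Union>\<V> \<subseteq> power_set n X" "power_set n X \<notin> \<V>"
    "\<forall>U\<in>\<V>. openin (Metric_space.mtopology (power_set n X) (power_dist n d)) U"
    using cover \<V> unfolding open_bs_cover_def by auto
  ultimately have "open_bs_cover (power_set n X) (power_dist n d) (power_bornology n \<BB>) \<V>"
    using small unfolding open_bs_cover_def by (intro conjI ballI) auto
  then show "\<exists>\<V>\<subseteq>\<U>. open_bs_cover (power_set n X) (power_dist n d) (power_bornology n \<BB>) \<V> \<and>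
      |\<V>| <o |\<U>|"
    using \<V> less by blast
qed

section \<open>Separated sets under the covering property\<close>

text \<open>Regularity keeps a smaller set from being cofinal. Since \<open>cofinal\<close> asks for
  strictly larger elements, a witness of its failure is, by totality, a weak upper bound.\<close>

lemma regularCard_bounded:
  assumes "regularCard |D|" "|S| <o |D|" "S \<subseteq> D"
  obtains a where "a \<in> D" "\<And>b. b \<in> S \<Longrightarrow> (b, a) \<in> |D|"
proof -
  have "\<not> cofinal S |D|"
    using assms not_ordLess_ordIso unfolding regularCard_def by (metis Field_card_of)
  then obtain a where a: "a \<in> D" "\<forall>b\<in>S. a = b \<or> (a, b) \<notin> |D|"
    unfolding cofinal_def by (auto simp: Field_card_of)
  have "(b, a) \<in> |D|" if "b \<in> S" for b
    using a that assms(3) card_of_Well_order[of D]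
    unfolding order_on_defs refl_on_def total_on_def by (metis Field_card_of subsetD)
  then show thesis using that a by blast
qed

text \<open>The space is arbitrary because the lemma is applied to the first power rather than to
  \<open>X\<close>. The hypothesis \<open>fin\<close> is what makes the cover by complements of
  tails a strong one.\<close>

lemma card_of_separated_le:
  assumes M: "Metric_space M d" and \<BB>: "\<Union>\<BB> = M" and m: "Cinfinite \<mm>"
    and reg: "regular_bs_space_infinity M d \<BB> (cardSuc \<mm>)"
    and D: "D \<subseteq> M" and \<epsilon>: "\<epsilon> > 0" "\<And>x y. x \<in> D \<Longrightarrow> y \<in> D \<Longrightarrow> x \<noteq> y \<Longrightarrow> \<epsilon> \<le> d x y"
    and fin: "\<And>B. B \<in> \<BB> \<Longrightarrow> \<exists>\<delta>>0. finite (enlargement M d B \<delta> \<inter> D)"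
  shows "|D| \<le>o \<mm>"
proof (rule ccontr)
  interpret Metric_space M d by fact
  assume "\<not> |D| \<le>o \<mm>"
  then have "\<mm> <o |D|"
    using m card_of_Well_order not_ordLeq_iff_ordLess card_order_on_well_order_on by metis
  then have "cardSuc \<mm> \<le>o |D|" using m cardSuc_least card_of_Card_order by blast
  moreover have suc: "Cinfinite (cardSuc \<mm>)" "regularCard (cardSuc \<mm>)"
    using m Cinfinite_cardSuc regularCard_cardSuc by auto
  \<comment> \<open>The cardinality of \<open>D\<close> may be singular; a subset \<open>E\<close>
    of cardinality exactly the successor of \<open>\<mm>\<close> has a regular one.\<close>
  ultimately have "|Field (cardSuc \<mm>)| \<le>o |D|"
    using card_of_Field_ordIso ordIso_ordLeq_trans by blast
  then obtain E where E: "E \<subseteq> D" "|Field (cardSuc \<mm>)| =o |E|"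
    using internalize_card_of_ordLeq2 by metis
  have iso: "cardSuc \<mm> =o |E|"
    using E(2) suc card_of_Field_ordIso ordIso_symmetric ordIso_transitive by blast
  have regE: "regularCard |E|" using regularCard_ordIso[OF iso] suc by blast
  have "Cinfinite |E|" using Cinfinite_cong[OF iso] suc by blast
  then have infE: "infinite E" by (simp add: cinfinite_def Field_card_of)
  define U where "U a = M - {b. (a, b) \<in> |E| \<and> a \<noteq> b}" for a
  have "antisym |E|" using card_of_Well_order[of E] unfolding order_on_defs by blast
  have limit: "\<exists>b\<in>E. a \<noteq> b \<and> (a, b) \<in> |E|" if "a \<in> E" for a
    using infinite_Card_order_limit[OF card_of_Card_order, of E a] infE that
    by (simp add: Field_card_of)
  have rE: "b \<in> E" if "(a, b) \<in> |E|" for a b using that Field_card_of[of E] by (auto simp: Field_def)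
  \<comment> \<open>Of two indices the later one lies in its own set but not in the set of the
    earlier one. Injectivity gives the cover the cardinality of \<open>E\<close>, hence a regular
    one.\<close>
  have "inj_on U E"
  proof (rule inj_onI, rule ccontr)
    fix a b assume ab: "a \<in> E" "b \<in> E" "U a = U b" "a \<noteq> b"
    have "(a, b) \<in> |E| \<or> (b, a) \<in> |E|"
      using ab card_of_Well_order[of E] unfolding order_on_defs total_on_def
      by (metis Field_card_of)
    moreover have "a \<in> M" "b \<in> M" using ab E D by auto
    ultimately show False using ab \<open>antisym |E|\<close> unfolding U_def antisym_def by blast
  qed
  then have card_U: "|U ` S| =o |S|" if "S \<subseteq> E" for S
    using that by (meson card_of_ordIso inj_on_imp_bij_betw inj_on_subset ordIso_symmetric)
  have "openin mtopology (U a)" for a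
    unfolding openin_mtopology
  proof (intro conjI allI impI)
    show "U a \<subseteq> M" by (auto simp: U_def)
    fix x assume x: "x \<in> U a"
    show "\<exists>r>0. mball x r \<subseteq> U a"
    \<comment> \<open>By separation at most one removed point lies within
      \<open>\<epsilon> / 2\<close> of \<open>x\<close>. If there is one, the ball of radius
      \<open>d x y\<close> excludes it as well.\<close>
    proof (cases "\<exists>y\<in>E - U a. d x y < \<epsilon> / 2")
      case True
      then obtain y where y: "y \<in> E" "y \<notin> U a" "d x y < \<epsilon> / 2" by blast
      have xy: "x \<in> M" "y \<in> M" "x \<noteq> y" using x y E D by (auto simp: U_def)
      have "z \<in> U a" if "z \<in> mball x (d x y)" for z
      proof (rule ccontr)
        assume "z \<notin> U a"
        then have "z \<in> E" using that rE by (auto simp: U_def)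
        moreover have "y \<noteq> z" using that by auto
        ultimately have "\<epsilon> \<le> d y z" using y E \<epsilon>(2) by blast
        moreover have "d y z \<le> d x y + d x z"
          using triangle[of y x z] xy that commute by auto
        ultimately show False using y(3) that by simp
      qed
      then show ?thesis using xy mdist_pos_less by blast
    next
      case False
      then have "mball x (\<epsilon> / 2) \<subseteq> U a"
        using rE by (force simp: U_def)
      then show ?thesis using \<epsilon>(1) half_gt_zero by blast
    qed
  qed
  moreover have small: "\<exists>V\<in>U ` E. \<exists>\<delta>>0. enlargement M d B \<delta> \<subseteq> V" if B: "B \<in> \<BB>" for B
  proof -
    \<comment> \<open>Some enlargement of \<open>B\<close> meets \<open>E\<close> in a finite set,
      which has an upper bound \<open>a\<close>; only points beyond \<open>a\<close> are missing
      from \<open>U a\<close>.\<close>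
    obtain \<delta> where \<delta>: "\<delta> > 0" "finite (enlargement M d B \<delta> \<inter> D)" using fin B by blast
    then have "finite (enlargement M d B \<delta> \<inter> E)"
      using E(1) by (meson Int_mono finite_subset order_refl)
    then have "|enlargement M d B \<delta> \<inter> E| <o |E|"
      using infE finite_ordLess_infinite[OF card_of_Well_order card_of_Well_order]
      by (metis Field_card_of)
    then obtain a where a: "a \<in> E" "\<And>b. b \<in> enlargement M d B \<delta> \<inter> E \<Longrightarrow> (b, a) \<in> |E|"
      using regularCard_bounded[OF regE] by (metis Int_lower2)
    have "enlargement M d B \<delta> \<subseteq> M" by (auto simp: enlargement_def)
    then have "enlargement M d B \<delta> \<subseteq> U a"
      using a rE \<open>antisym |E|\<close> unfolding U_def antisym_def by blast
    then show ?thesis using a \<delta> by blast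
  qed
  moreover have "M \<subseteq> \<Union>(U ` E)"
  proof
    fix x assume x: "x \<in> M"
    then obtain B where B: "B \<in> \<BB>" "x \<in> B" using \<BB> by blast
    then obtain V \<delta> where "V \<in> U ` E" "\<delta> > 0" "enlargement M d B \<delta> \<subseteq> V" using small by blast
    moreover have "x \<in> enlargement M d B \<delta>" if "\<delta> > 0" for \<delta>
      using B x that centre_in_mball_iff unfolding enlargement_def by blast
    ultimately show "x \<in> \<Union>(U ` E)" by blast
  qed
  moreover have "M \<noteq> U a" if "a \<in> E" for a
  proof -
    obtain b where "b \<in> E" "a \<noteq> b" "(a, b) \<in> |E|" using limit \<open>a \<in> E\<close> by blast
    then show ?thesis using E(1) D unfolding U_def by blast
  qed
  ultimately have "open_bs_cover M d \<BB> (U ` E)"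
    unfolding open_bs_cover_def by (intro conjI ballI) (auto simp: U_def)
  moreover have UE: "|E| =o |U ` E|" using card_U ordIso_symmetric by blast
  then have "regularCard |U ` E|" "cardSuc \<mm> \<le>o |U ` E|"
    using regularCard_ordIso[OF UE] regE \<open>Cinfinite |E|\<close> iso
      ordIso_transitive ordIso_iff_ordLeq by blast+
  ultimately obtain \<V> where \<V>: "\<V> \<subseteq> U ` E" "open_bs_cover M d \<BB> \<V>" "|\<V>| <o |U ` E|"
    using reg unfolding regular_bs_space_infinity_iff by blast
  obtain S where S: "S \<subseteq> E" "\<V> = U ` S" using \<V>(1) by (meson subset_imageE)
  have "|S| <o |E|"
    using \<V>(3) UE card_U[OF S(1)] S(2) ordIso_ordLess_trans ordLess_ordIso_trans ordIso_symmetric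
    by metis
  then obtain a where a: "a \<in> E" "\<And>b. b \<in> S \<Longrightarrow> (b, a) \<in> |E|"
    using regularCard_bounded[OF regE _ S(1)] by blast
  \<comment> \<open>The point \<open>c\<close> comes after every index in \<open>S\<close>, so every
    member of the smaller subcover misses it.\<close>
  obtain c where c: "c \<in> E" "a \<noteq> c" "(a, c) \<in> |E|" using limit a by blast
  have "c \<notin> U b" if "b \<in> S" for b
    using a(2)[OF that] c \<open>antisym |E|\<close> card_of_Well_order[of E]
    unfolding U_def order_on_defs trans_def antisym_def by blast
  moreover have "c \<in> \<Union>\<V>" using \<V>(2) c E D unfolding open_bs_cover_def by blast
  ultimately show False using S by blast
qed

section \<open>Separated nets and total boundedness\<close>

text \<open>Zorn's lemma: a point at distance at least \<open>\<epsilon>\<close> from a maximal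
  separated set could be added to it.\<close>

lemma maximal_separated:
  assumes M: "Metric_space M d" and \<epsilon>: "\<epsilon> > 0"
  obtains D where "D \<subseteq> M" "\<And>x y. x \<in> D \<Longrightarrow> y \<in> D \<Longrightarrow> x \<noteq> y \<Longrightarrow> \<epsilon> \<le> d x y"
    "\<And>x. x \<in> M \<Longrightarrow> \<exists>q\<in>D. d x q < \<epsilon>"
proof -
  interpret Metric_space M d by fact
  let ?P = "{D. D \<subseteq> M \<and> (\<forall>x\<in>D. \<forall>y\<in>D. x \<noteq> y \<longrightarrow> \<epsilon> \<le> d x y)}"
  have "\<exists>D\<in>?P. \<forall>E\<in>?P. D \<subseteq> E \<longrightarrow> E = D"
  proof (rule subset_Zorn')
    fix C assume C: "subset.chain ?P C"
    show "\<Union>C \<in> ?P"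
    proof (intro CollectI conjI ballI impI)
      show "\<Union>C \<subseteq> M" using C by (auto simp: subset.chain_def)
      fix x y assume xy: "x \<in> \<Union>C" "y \<in> \<Union>C" "x \<noteq> y"
      then obtain E E' where E: "E \<in> C" "x \<in> E" "E' \<in> C" "y \<in> E'" by blast
      then have "E \<subseteq> E' \<or> E' \<subseteq> E" and "E \<in> ?P" "E' \<in> ?P"
        using C unfolding subset_chain_def by blast+
      then show "\<epsilon> \<le> d x y" using E xy(3) by auto
    qed
  qed
  then obtain D where D: "D \<in> ?P" "\<forall>E\<in>?P. D \<subseteq> E \<longrightarrow> E = D" by (rule bexE)
  have "\<exists>q\<in>D. d x q < \<epsilon>" if x: "x \<in> M" for x
  proof (rule ccontr)
    assume far: "\<not> (\<exists>q\<in>D. d x q < \<epsilon>)"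
    then have "insert x D \<in> ?P" using D(1) x commute by (force simp: not_less)
    then have "insert x D = D" by (intro D(2)[rule_format]) auto
    then have "x \<in> D" by blast
    then show False using far \<epsilon> x by (metis mdist_zero)
  qed
  moreover have "D \<subseteq> M" "\<And>x y. x \<in> D \<Longrightarrow> y \<in> D \<Longrightarrow> x \<noteq> y \<Longrightarrow> \<epsilon> \<le> d x y" using D(1) by auto
  ultimately show thesis by (rule that[rotated 2])
qed

text \<open>The compact base enters the proof in this form.\<close>

lemma compact_base_mtotally_bounded:
  assumes X: "Metric_space X d" and "has_compact_base X d \<BB>" "B \<in> \<BB>"
  shows "Metric_space.mtotally_bounded X d B"
proof -
  interpret Metric_space X d by fact
  obtain K where "compactin mtopology K" "B \<subseteq> K"
    using assms(2,3) unfolding has_compact_base_def bornology_base_def by blast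
  then show ?thesis using compactin_imp_mtotally_bounded mtotally_bounded_subset by blast
qed

text \<open>Finitely many \<open>\<epsilon>/4\<close>-balls cover \<open>B\<close>, so the balls of
  radius \<open>\<epsilon>/2\<close> with the same centres cover its
  \<open>\<epsilon>/4\<close>-enlargement. Each has room for at most one point of
  \<open>D\<close>.\<close>

lemma finite_enlargement_Int_separated:
  assumes X: "Metric_space X d" and B: "Metric_space.mtotally_bounded X d B"
    and \<epsilon>: "\<epsilon> > 0" "\<And>x y. x \<in> D \<Longrightarrow> y \<in> D \<Longrightarrow> x \<noteq> y \<Longrightarrow> \<epsilon> \<le> d x y"
  shows "finite (enlargement X d B (\<epsilon>/4) \<inter> D)"
proof -
  interpret Metric_space X d by fact
  have "\<epsilon>/4 > 0" using \<epsilon>(1) by simp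
  then obtain K where K: "finite K" "B \<subseteq> (\<Union>x\<in>K. mball x (\<epsilon>/4))"
    using B unfolding mtotally_bounded_def by meson
  have "enlargement X d B (\<epsilon>/4) \<subseteq> (\<Union>x\<in>K. mball x (\<epsilon>/2))"
  proof
    fix y assume "y \<in> enlargement X d B (\<epsilon>/4)"
    then obtain b where b: "b \<in> B" "b \<in> X" "y \<in> X" "d b y < \<epsilon>/4" by (auto simp: enlargement_def)
    then obtain x where "x \<in> K" "x \<in> X" "d x b < \<epsilon>/4" using K(2) by force
    then show "y \<in> (\<Union>x\<in>K. mball x (\<epsilon>/2))" using b triangle[of x b y] by force
  qed
  then have "enlargement X d B (\<epsilon>/4) \<inter> D \<subseteq> (\<Union>x\<in>K. mball x (\<epsilon>/2) \<inter> D)" by blast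
  moreover have "finite (mball x (\<epsilon>/2) \<inter> D)" for x
  proof -
    have "y = z" if "y \<in> mball x (\<epsilon>/2) \<inter> D" "z \<in> mball x (\<epsilon>/2) \<inter> D" for y z
    proof (rule ccontr)
      assume "y \<noteq> z"
      then have "\<epsilon> \<le> d y z" using \<epsilon>(2) that by blast
      then show False using that triangle[of y x z] commute[of x y] by auto
    qed
    then show ?thesis by (metis finite.simps finite_insert is_singletonI' is_singleton_def)
  qed
  ultimately show ?thesis using K(1) by (meson finite_UN_I finite_subset)
qed

text \<open>Products with an infinite cardinal do not raise it, which bounds each length by
  induction; then countably many lengths are united. The lists will code finite sets of ball
  centres.\<close>

lemma card_of_lists_ordLeq:
  assumes r: "Cinfinite r" and A: "|A| \<le>o r"
  shows "|lists A| \<le>o r"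
proof -
  have inf: "infinite (Field r)" "Card_order r" using r by (auto simp: cinfinite_def)
  have "|{xs \<in> lists A. length xs = n}| \<le>o r" for n
  proof (induction n)
    case 0
    have "{xs \<in> lists A. length xs = 0} = {[]}" by auto
    then show ?case
      using inf Card_order_singl_ordLeq by (metis finite.emptyI)
  next
    case (Suc n)
    have "{xs \<in> lists A. length xs = Suc n} =
        (\<lambda>(x, xs). x # xs) ` (A \<times> {xs \<in> lists A. length xs = n})"
      by (auto simp: length_Suc_conv image_iff)
    then have "|{xs \<in> lists A. length xs = Suc n}| \<le>o |A \<times> {xs \<in> lists A. length xs = n}|"
      by (simp only: card_of_image)
    then show ?case
      using card_of_Times_ordLeq_infinite_Field[OF inf(1) A Suc inf(2)] ordLeq_transitive by blast
  qed
  moreover have "|UNIV :: nat set| \<le>o r"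
    using inf infinite_iff_card_of_nat card_of_Field_ordIso ordLeq_ordIso_trans by blast
  ultimately have "|\<Union>n. {xs \<in> lists A. length xs = n}| \<le>o r"
    using card_of_UNION_ordLeq_infinite_Field[OF inf(1), of UNIV "\<lambda>n. {xs \<in> lists A. length xs = n}"]
      inf(2) by blast
  moreover have "(\<Union>n. {xs \<in> lists A. length xs = n}) = lists A" by auto
  ultimately show ?thesis by simp
qed

section \<open>Density at most \<open>\<mm>\<close>\<close>

text \<open>The dense set is the union over \<open>n\<close> of maximal
  \<open>1/(n+1)\<close>-separated sets, each bounded by
  \<open>card_of_separated_le\<close>.\<close>

lemma small_dense_set:
  assumes X: "Metric_space X d" and \<BB>: "bornology_on X \<BB>" "has_compact_base X d \<BB>"
    and m: "Cinfinite \<mm>"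
    and reg: "regular_bs_space_infinity (power_set 1 X) (power_dist 1 d) (power_bornology 1 \<BB>)
      (cardSuc \<mm>)"
  obtains Q where "Q \<subseteq> X" "|Q| \<le>o \<mm>" "\<And>x r. x \<in> X \<Longrightarrow> r > 0 \<Longrightarrow> \<exists>q\<in>Q. d x q < r"
proof -
  interpret Metric_space X d by fact
  have sep: "|D| \<le>o \<mm>" if D: "D \<subseteq> X" and \<epsilon>: "\<epsilon> > 0"
    "\<And>x y. x \<in> D \<Longrightarrow> y \<in> D \<Longrightarrow> x \<noteq> y \<Longrightarrow> \<epsilon> \<le> d x y" for D \<epsilon>
  proof -
    \<comment> \<open>Constant functions identify \<open>X\<close> isometrically with its first
      power, where the covering property is given.\<close>
    let ?c = "\<lambda>x :: 'a. restrict (\<lambda>_. x) {..<1::nat}"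
    have P1: "power_set 1 B = ?c ` B" for B :: "'a set"
    proof (intro set_eqI iffI)
      fix y assume "y \<in> power_set 1 B"
      then have "y 0 \<in> B" "y = ?c (y 0)" by (auto simp: power_set_def PiE_iff extensional_def)
      then show "y \<in> ?c ` B" by blast
    next
      fix y assume "y \<in> ?c ` B"
      then obtain b where "b \<in> B" "y = ?c b" by blast
      then show "y \<in> power_set 1 B" by (simp add: power_set_def PiE_iff)
    qed
    have inj: "inj_on ?c A" for A by (auto intro!: inj_onI dest: fun_cong[of _ _ "0::nat"])
    have "|power_set 1 D| \<le>o \<mm>"
    proof (rule card_of_separated_le[OF Metric_space_power[OF X order_refl] _ m reg _ \<epsilon>(1)])
      have "\<Union>\<BB> = X" using \<BB>(1) unfolding bornology_on_def by (elim conjE)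
      then show "\<Union>(power_bornology 1 \<BB>) = power_set 1 X"
        unfolding power_bornology_def P1 by blast
      show "power_set 1 D \<subseteq> power_set 1 X" using D unfolding P1 by blast
      show "\<epsilon> \<le> power_dist 1 d x y" if xy: "x \<in> power_set 1 D" "y \<in> power_set 1 D" "x \<noteq> y" for x y
      proof -
        obtain a b where "a \<in> D" "b \<in> D" "x = ?c a" "y = ?c b" using xy unfolding P1 by blast
        with xy(3) show ?thesis using \<epsilon>(2)[of a b] by (auto simp: power_dist_def lessThan_Suc)
      qed
      fix B' assume "B' \<in> power_bornology 1 \<BB>"
      then obtain B where B: "B \<in> \<BB>" "B' \<subseteq> power_set 1 B" by (auto simp: power_bornology_def)
      have "finite (enlargement X d B (\<epsilon>/4) \<inter> D)"
        by (rule finite_enlargement_Int_separated[OF X compact_base_mtotally_bounded[OF X \<BB>(2) B(1)] \<epsilon>])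
      then have "finite (power_set 1 (enlargement X d B (\<epsilon>/4) \<inter> D))" unfolding P1 by blast
      moreover have "enlargement (power_set 1 X) (power_dist 1 d) B' (\<epsilon>/4) \<inter> power_set 1 D \<subseteq>
          power_set 1 (enlargement X d B (\<epsilon>/4)) \<inter> power_set 1 D"
        using enlargement_mono[OF Metric_space_power[OF X order_refl] B(2) order_refl, of "\<epsilon>/4"]
        unfolding enlargement_power[OF X order_refl] by blast
      moreover have "\<dots> \<subseteq> power_set 1 (enlargement X d B (\<epsilon>/4) \<inter> D)"
        by (auto simp: power_set_def PiE_iff)
      ultimately have "finite (enlargement (power_set 1 X) (power_dist 1 d) B' (\<epsilon>/4) \<inter> power_set 1 D)"
        by (meson finite_subset)
      then show "\<exists>\<delta>>0. finite (enlargement (power_set 1 X) (power_dist 1 d) B' \<delta> \<inter> power_set 1 D)"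
        using \<epsilon>(1) by (meson zero_less_divide_iff zero_less_numeral)
    qed
    moreover have "|D| =o |?c ` D|"
      by (rule card_of_ordIsoI[OF inj_on_imp_bij_betw[OF inj]])
    ultimately show ?thesis unfolding P1 by (rule ordIso_ordLeq_trans[rotated])
  qed
  have "\<exists>D\<subseteq>X. |D| \<le>o \<mm> \<and> (\<forall>x\<in>X. \<exists>q\<in>D. d x q < 1 / real (Suc n))" for n
  proof -
    have pos: "1 / real (Suc n) > 0" by simp
    obtain D where D: "D \<subseteq> X"
      "\<And>x y. x \<in> D \<Longrightarrow> y \<in> D \<Longrightarrow> x \<noteq> y \<Longrightarrow> 1 / real (Suc n) \<le> d x y"
      "\<And>x. x \<in> X \<Longrightarrow> \<exists>q\<in>D. d x q < 1 / real (Suc n)"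
      using maximal_separated[OF X pos] by blast
    have "|D| \<le>o \<mm>" by (rule sep[OF D(1) pos D(2)])
    then show ?thesis using D(1,3) by blast
  qed
  then obtain D where D: "\<And>n. D n \<subseteq> X" "\<And>n. |D n| \<le>o \<mm>"
    "\<And>n x. x \<in> X \<Longrightarrow> \<exists>q\<in>D n. d x q < 1 / real (Suc n)" by metis
  have inf: "infinite (Field \<mm>)" "Card_order \<mm>" using m by (auto simp: cinfinite_def)
  have "|UNIV :: nat set| \<le>o \<mm>"
    using inf infinite_iff_card_of_nat card_of_Field_ordIso ordLeq_ordIso_trans by blast
  then have "|\<Union>n. D n| \<le>o \<mm>"
    using card_of_UNION_ordLeq_infinite_Field[OF inf(1), of UNIV D] inf(2) D(2) by blast
  moreover have "\<exists>q\<in>\<Union>n. D n. d x q < r" if x: "x \<in> X" and r: "r > 0" for x r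
  proof -
    obtain n where "1 / real (Suc n) < r" using r nat_approx_posE by blast
    moreover obtain q where "q \<in> D n" "d x q < 1 / real (Suc n)" using D(3) x by blast
    ultimately show ?thesis by (meson UN_I UNIV_I order_less_trans)
  qed
  ultimately show thesis using that[of "\<Union>n. D n"] D(1) by blast
qed

section \<open>From density to T-tightness\<close>

lemma chain_unions_closed_if_small_dense_set:
  assumes X: "Metric_space X d" and \<BB>: "bornology_on X \<BB>" "has_compact_base X d \<BB>"
    and m: "Cinfinite \<mm>"
    and Q: "Q \<subseteq> X" "|Q| \<le>o \<mm>" "\<And>x r. x \<in> X \<Longrightarrow> r > 0 \<Longrightarrow> \<exists>q\<in>Q. d x q < r"
  shows "chain_unions_closed (strong_topology X d \<BB>) \<mm>"
  unfolding chain_unions_closed_def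
proof (intro allI impI, elim conjE)
  interpret Metric_space X d by fact
  let ?Y = "strong_topology X d \<BB>"
  fix \<kappa> :: "('a \<Rightarrow> real) set rel" and F
  assume k: "Card_order \<kappa>" "regularCard \<kappa>" "\<mm> <o \<kappa>"
    and closed: "\<forall>\<alpha>\<in>Field \<kappa>. closedin ?Y (F \<alpha>)" and chain: "relChain \<kappa> F"
  have FC: "F \<alpha> \<subseteq> cont_funs X d" if "\<alpha> \<in> Field \<kappa>" for \<alpha>
    using closed that closedin_subset topspace_strong_topology[OF X \<BB>(1)] by blast
  define G where "G xs j = (\<Union>q\<in>set xs. mball q (1 / real (Suc j)))" for xs and j :: nat
  have "?Y closure_of (\<Union>\<alpha>\<in>Field \<kappa>. F \<alpha>) \<subseteq> (\<Union>\<alpha>\<in>Field \<kappa>. F \<alpha>)"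
  proof
    fix f assume f: "f \<in> ?Y closure_of (\<Union>\<alpha>\<in>Field \<kappa>. F \<alpha>)"
    have fC: "f \<in> cont_funs X d"
      and approx: "\<And>B \<epsilon>. B \<in> \<BB> \<Longrightarrow> \<epsilon> > 0 \<Longrightarrow>
        \<exists>g\<in>\<Union>\<alpha>\<in>Field \<kappa>. F \<alpha>. (f, g) \<in> strong_entourage X d B \<epsilon>"
      using f FC in_strong_closure_of_iff[OF X \<BB>(1), of "\<Union>\<alpha>\<in>Field \<kappa>. F \<alpha>" f] by blast+
    \<comment> \<open>A triple codes a test: a finite union of balls and a tolerance.
      \<open>As \<alpha>\<close> collects the tests that some member of \<open>F \<alpha>\<close>
      passes as an approximation of \<open>f\<close>.\<close>
    define As where "As \<alpha> = {(xs, j, k :: nat). xs \<in> lists Q \<and>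
      (\<exists>g\<in>F \<alpha>. \<forall>x\<in>G xs j. \<bar>f x - g x\<bar> < 1 / real (Suc k))}" for \<alpha>
    let ?B = "\<Union>\<alpha>\<in>Field \<kappa>. As \<alpha>"
    have inf: "infinite (Field \<mm>)" "Card_order \<mm>" using m by (auto simp: cinfinite_def)
    have nat: "|UNIV :: nat set| \<le>o \<mm>"
      using inf infinite_iff_card_of_nat card_of_Field_ordIso ordLeq_ordIso_trans by blast
    have "|lists Q \<times> (UNIV :: nat set) \<times> (UNIV :: nat set)| \<le>o \<mm>"
      by (intro card_of_Times_ordLeq_infinite_Field inf nat card_of_lists_ordLeq m Q(2))
    moreover have "?B \<subseteq> lists Q \<times> UNIV \<times> UNIV" by (auto simp: As_def)
    ultimately have "|?B| <o \<kappa>"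
      using k(3) card_of_mono1 ordLeq_transitive ordLeq_ordLess_trans by meson
    moreover have "relChain \<kappa> As"
      using chain unfolding relChain_def As_def by fast
    moreover have "cinfinite \<kappa>" using Cinfinite_ordLess m k(1,3) by blast
    \<comment> \<open>There are at most \<open>\<mm>\<close> tests, fewer than the regular
      \<open>\<kappa>\<close>, so one stage already passes every test that any stage passes.\<close>
    ultimately have "\<exists>\<alpha>\<in>Field \<kappa>. ?B \<subseteq> As \<alpha>"
      using k by (intro regularCard_UNION) (auto simp: cinfinite_def)
    then obtain \<alpha> where \<alpha>: "\<alpha> \<in> Field \<kappa>" "?B \<subseteq> As \<alpha>" by blast
    have "\<exists>g\<in>F \<alpha>. (f, g) \<in> strong_entourage X d B \<epsilon>" if B: "B \<in> \<BB>" and \<epsilon>: "\<epsilon> > 0" for B \<epsilon>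
    proof -
      obtain k where k: "1 / real (Suc k) < \<epsilon>" using \<epsilon> nat_approx_posE by blast
      have "1 / real (Suc k) > 0" by simp
      then obtain \<beta> g \<delta> where g: "\<beta> \<in> Field \<kappa>" "g \<in> F \<beta>" "\<delta> > 0"
        "\<forall>x\<in>enlargement X d B \<delta>. \<bar>f x - g x\<bar> < 1 / real (Suc k)"
        using approx[OF B, of "1 / real (Suc k)"] unfolding strong_entourage_def by blast
      \<comment> \<open>The goal is a test set \<open>G xs j\<close> between the
        \<open>r/4\<close>-enlargement and the \<open>\<delta>\<close>-enlargement of
        \<open>B\<close>, where \<open>r = 1/(j+1)\<close>. The net \<open>T\<close> lies in
        \<open>B\<close> and \<open>p\<close> moves it into \<open>Q\<close> by less than
        \<open>r/4\<close>. The outer inclusion costs \<open>r/4 + r < 2 * r < \<delta>\<close>, the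
        inner one three steps of \<open>r/4\<close>.\<close>
      obtain j where j: "1 / real (Suc j) < \<delta> / 2" using g(3) nat_approx_posE half_gt_zero by blast
      define r where "r = 1 / real (Suc j)"
      have r: "r > 0" "2 * r < \<delta>" using j by (auto simp: r_def)
      obtain T where T: "finite T" "T \<subseteq> B" "B \<subseteq> (\<Union>t\<in>T. mball t (r/4))"
        using compact_base_mtotally_bounded[OF X \<BB>(2) B] r(1)
        unfolding mtotally_bounded_def by (meson zero_less_divide_iff zero_less_numeral)
      have BX: "B \<subseteq> X" using \<BB>(1) B unfolding bornology_on_def by blast
      then have "\<forall>t\<in>T. \<exists>q\<in>Q. d t q < r/4"
        using T(2) Q(3) r(1) by (metis in_mono zero_less_divide_iff zero_less_numeral)
      then obtain p where p: "\<And>t. t \<in> T \<Longrightarrow> p t \<in> Q \<and> d t (p t) < r/4" by metis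
      obtain xs where xs: "set xs = p ` T" using T(1) by (meson finite_imageI finite_list)
      have "G xs j \<subseteq> enlargement X d B \<delta>"
      proof
        fix x assume "x \<in> G xs j"
        then obtain t where t: "t \<in> T" "x \<in> X" "p t \<in> X" "d (p t) x < r"
          unfolding G_def xs r_def by auto
        moreover have "t \<in> X" "d t (p t) < r/4" using t p T BX by auto
        ultimately have "d t x < \<delta>" using triangle[of t "p t" x] r by linarith
        then show "x \<in> enlargement X d B \<delta>"
          using t \<open>t \<in> X\<close> T by (auto simp: enlargement_def)
      qed
      moreover have "xs \<in> lists Q" using xs p by (auto simp: lists_eq_set)
      ultimately have "(xs, j, k) \<in> As \<beta>" using g unfolding As_def by blast
      \<comment> \<open>The approximation \<open>g\<close> from stage \<open>\<beta>\<close> is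
        traded for some \<open>h\<close> at the fixed stage \<open>\<alpha>\<close> passing the same
        test.\<close>
      then have "(xs, j, k) \<in> As \<alpha>" using \<alpha>(2) g(1) by blast
      then obtain h where h: "h \<in> F \<alpha>" "\<forall>x\<in>G xs j. \<bar>f x - h x\<bar> < 1 / real (Suc k)"
        unfolding As_def by blast
      have "enlargement X d B (r/4) \<subseteq> G xs j"
      proof
        fix x assume "x \<in> enlargement X d B (r/4)"
        then obtain b where b: "b \<in> B" "b \<in> X" "x \<in> X" "d b x < r/4"
          by (auto simp: enlargement_def)
        then obtain t where t: "t \<in> T" "t \<in> X" "d t b < r/4" using T(3) by force
        have "p t \<in> X" "d t (p t) < r/4" using p t Q(1) by auto
        then have "d (p t) x < r"
          using triangle[of "p t" t x] triangle[of t b x] b t commute[of t "p t"] r(1) by simp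
        then show "x \<in> G xs j"
          using t b \<open>p t \<in> X\<close> unfolding G_def xs r_def by auto
      qed
      moreover have "r/4 > 0" using r by simp
      ultimately have "(f, h) \<in> strong_entourage X d B \<epsilon>"
        using h k fC FC[OF \<alpha>(1)] unfolding strong_entourage_def
        by (auto intro!: exI[of _ "r/4"]) (meson order_less_trans subsetD)
      then show ?thesis using h(1) by blast
    qed
    then have "f \<in> ?Y closure_of F \<alpha>"
      using fC in_strong_closure_of_iff[OF X \<BB>(1) FC[OF \<alpha>(1)]] by blast
    then show "f \<in> (\<Union>\<alpha>\<in>Field \<kappa>. F \<alpha>)" using closed \<alpha>(1) closure_of_closedin by blast
  qed
  then show "closedin ?Y (\<Union>\<alpha>\<in>Field \<kappa>. F \<alpha>)"
    using closure_of_subset_eq[of "\<Union>\<alpha>\<in>Field \<kappa>. F \<alpha>" ?Y] FC topspace_strong_topology[OF X \<BB>(1)]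
    by (simp add: UN_least)
qed

theorem theorem3p8:
  fixes X :: "'a set" and d :: "'a \<Rightarrow> 'a \<Rightarrow> real"
    and \<BB> :: "'a set set" and \<mm> :: "'m rel"
  assumes "Metric_space X d" and "infinite X"
    and "bornology_on X \<BB>" and "has_compact_base X d \<BB>" and "X \<notin> \<BB>"
    and "Card_order \<mm>" and "cinfinite \<mm>"
  shows "T_tightness (strong_topology X d \<BB>) \<le>o \<mm> \<longleftrightarrow>
    (\<forall>n::nat. n \<ge> 1 \<longrightarrow>
       regular_bs_space_infinity (power_set n X) (power_dist n d) (power_bornology n \<BB>)
         (cardSuc \<mm>))"
proof -
  have m: "Cinfinite \<mm>" using assms(6,7) by blast
  show ?thesis
    \<comment> \<open>Bounding the least cardinal by \<open>\<mm>\<close> amounts to the chain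
      condition at \<open>\<mm>\<close>, with which both directions work.\<close>
    unfolding T_tightness_least[OF m]
  proof (intro iffI allI impI)
    fix n :: nat
    assume "chain_unions_closed (strong_topology X d \<BB>) \<mm>" "n \<ge> 1"
    then show "regular_bs_space_infinity (power_set n X) (power_dist n d) (power_bornology n \<BB>)
        (cardSuc \<mm>)"
      by (rule regular_bs_space_power[OF assms(1,3) m])
  next
    assume "\<forall>n::nat. n \<ge> 1 \<longrightarrow>
      regular_bs_space_infinity (power_set n X) (power_dist n d) (power_bornology n \<BB>) (cardSuc \<mm>)"
    then have "regular_bs_space_infinity (power_set 1 X) (power_dist 1 d) (power_bornology 1 \<BB>)
        (cardSuc \<mm>)" by simp
    then obtain Q where "Q \<subseteq> X" "|Q| \<le>o \<mm>" "\<And>x r. x \<in> X \<Longrightarrow> r > 0 \<Longrightarrow> \<exists>q\<in>Q. d x q < r"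
      using small_dense_set[OF assms(1,3,4) m] by metis
    then show "chain_unions_closed (strong_topology X d \<BB>) \<mm>"
      by (rule chain_unions_closed_if_small_dense_set[OF assms(1,3,4) m])
  qed
qed

end
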